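(* Let $p\in(0,1)$. For each $n$ let $G=G_n$ and $H=H_n$ be independent Erdős–Rényi graphs $G(n,p)$, and let $u\in V(G)$, $v\in V(H)$ be fixed vertices (e.g. $u=v=1$). Then $$\mathrm{Eff}^{G\times H}((u,v))\to \frac{1}{2}+\frac{1}{2}p^2\quad\text{as } n\to\infty,$$ with probability one.
   Context: An Erdős–Rényi graph $G(n,p)$ is a random simple graph on $\{1,\dots,n\}$ with each edge present independently with probability $p$; for almost sure statements $G_n$ (resp. $H_n$) is realized as the subgraph induced on $\{1,\dots,n\}$ of a random graph on $\mathbb{N}$ with independent edges of probability $p$, the two being independent. The tensor product $G\times H$ has vertex set $V(G)\times V(H)$, with $(v_1,v_2)$ adjacent to $(v_1',v_2')$ iff $v_1v_1'\in E(G)$ and $v_2v_2'\in E(H)$. For a graph $F$ and vertex $i$, $N(i)$ is the set of neighbours of $i$ ($i\notin N(i)$), $d^F(i)=|N(i)|$, and the local efficiency is $\mathrm{Eff}^F(i)=\binom{d^F(i)}{2}^{-1}\sum_{\{j,k\}\subset N(i)}\frac{1}{\mathrm{dist}(j,k)}$ (sum over unordered pairs of distinct neighbours, $\mathrm{dist}$ the graph distance in $F$; defined when $d^F(i)\ge 2$). *)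

theory Defs
  imports "HOL-Probability.Probability" "HOL-Library.Ramsey" "HOL-Library.Extended_Nat"
begin

section \<open>Simple graphs\<close>

record 'a ugraph =
  verts :: "'a set"
  edges :: "'a set set"

definition simple_graph :: "'a ugraph \<Rightarrow> bool" where
  "simple_graph F \<longleftrightarrow> edges F \<subseteq> [verts F]\<^bsup>2\<^esup>"

definition induced :: "'a ugraph \<Rightarrow> 'a set \<Rightarrow> 'a ugraph" where
  "induced F S = \<lparr>verts = verts F \<inter> S, edges = {e \<in> edges F. e \<subseteq> S}\<rparr>"

definition tensor_product :: "'a ugraph \<Rightarrow> 'b ugraph \<Rightarrow> ('a \<times> 'b) ugraph" where
  "tensor_product G H =
     \<lparr>verts = verts G \<times> verts H,
      edges = {{(a, b), (a', b')} | a b a' b'. {a, a'} \<in> edges G \<and> {b, b'} \<in> edges H}\<rparr>"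

definition nbrs :: "'a ugraph \<Rightarrow> 'a \<Rightarrow> 'a set" where
  "nbrs F i = {j. {i, j} \<in> edges F}"

definition vdeg :: "'a ugraph \<Rightarrow> 'a \<Rightarrow> nat" where
  "vdeg F i = card (nbrs F i)"

definition walk :: "'a ugraph \<Rightarrow> 'a \<Rightarrow> 'a list \<Rightarrow> 'a \<Rightarrow> bool" where
  "walk F x xs y \<longleftrightarrow> xs \<noteq> [] \<and> hd xs = x \<and> last xs = y \<and> set xs \<subseteq> verts F \<and>
     successively (\<lambda>a b. {a, b} \<in> edges F) xs"

definition gdist :: "'a ugraph \<Rightarrow> 'a \<Rightarrow> 'a \<Rightarrow> enat" where
  "gdist F x y = (INF xs \<in> {xs. walk F x xs y}. enat (length xs - 1))"

text \<open>The reciprocal distance, with the usual convention \<open>1 / \<infinity> = 0\<close>.\<close>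

definition inv_dist :: "'a ugraph \<Rightarrow> 'a \<Rightarrow> 'a \<Rightarrow> real" where
  "inv_dist F x y = (case gdist F x y of enat k \<Rightarrow> 1 / real k | \<infinity> \<Rightarrow> 0)"

text \<open>
  The sum ranges over unordered pairs; the summand is the common value of
  \<open>1 / dist(j,k)\<close> over the two orderings of the pair (see \<open>inv_dist_unordered\<close> below).
  If the degree is less than 2, the value is 0 because \<open>inverse 0 = 0\<close>. In particular,
  convergence to a positive limit entails that the degree is eventually at least 2.
\<close>

definition local_efficiency :: "'a ugraph \<Rightarrow> 'a \<Rightarrow> real" where
  "local_efficiency F i =
     inverse (real (vdeg F i choose 2)) *
     (\<Sum>e \<in> [nbrs F i]\<^bsup>2\<^esup>. THE r. \<forall>j k. e = {j, k} \<longrightarrow> r = inv_dist F j k)"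

lemma walk_rev: "walk F x xs y \<Longrightarrow> walk F y (rev xs) x"
  by (auto simp: walk_def hd_rev last_rev insert_commute)

lemma gdist_sym: "gdist F x y = gdist F y x"
proof -
  have le: "gdist F a b \<le> gdist F b a" for a b
    unfolding gdist_def
    by (rule INF_mono) (metis length_rev mem_Collect_eq order_refl walk_rev)
  show ?thesis
    by (intro antisym le)
qed

lemma inv_dist_unordered:
  "(THE r. \<forall>j k. {a, b} = {j, k} \<longrightarrow> r = inv_dist F j k) = inv_dist F a b"
proof (rule the_equality)
  show "\<forall>j k. {a, b} = {j, k} \<longrightarrow> inv_dist F a b = inv_dist F j k"
    using gdist_sym[of F a b] by (auto simp: doubleton_eq_iff inv_dist_def)
qed blast

lemma simple_graph_induced: "simple_graph F \<Longrightarrow> simple_graph (induced F S)"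
  by (auto simp: simple_graph_def induced_def nsets_def)

lemma simple_graph_tensor_product:
  assumes "simple_graph G" "simple_graph H"
  shows "simple_graph (tensor_product G H)"
  using assms by (fastforce simp: simple_graph_def tensor_product_def nsets_def card_2_iff)

section \<open>Random graphs\<close>

definition edge_event :: "'w measure \<Rightarrow> ('w \<Rightarrow> 'a ugraph) \<Rightarrow> 'a set \<Rightarrow> 'w set" where
  "edge_event M R e = {\<omega> \<in> space M. e \<in> edges (R \<omega>)}"

text \<open>
  A random simple graph with vertex set \<open>V\<close> (finite or countable) and independent edges of
  probability \<open>p\<close>. For \<open>V = {1..n}\<close> this says that \<open>R\<close> is an Erdos-Renyi graph \<open>G(n,p)\<close>.
\<close>

definition erdos_renyi :: "'w measure \<Rightarrow> 'a set \<Rightarrow> real \<Rightarrow> ('w \<Rightarrow> 'a ugraph) \<Rightarrow> bool" where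
  "erdos_renyi M V p R \<longleftrightarrow>
     (\<forall>\<omega> \<in> space M. simple_graph (R \<omega>) \<and> verts (R \<omega>) = V) \<and>
     prob_space.indep_events M (edge_event M R) ([V]\<^bsup>2\<^esup>) \<and>
     (\<forall>e \<in> [V]\<^bsup>2\<^esup>. measure M (edge_event M R e) = p)"

text \<open>Independence of two random graphs: the generated sigma-algebras are independent.\<close>

definition graph_sigma :: "'w measure \<Rightarrow> 'a set \<Rightarrow> ('w \<Rightarrow> 'a ugraph) \<Rightarrow> 'w set set" where
  "graph_sigma M V R = sigma_sets (space M) (edge_event M R ` [V]\<^bsup>2\<^esup>)"

definition indep_graphs ::
  "'w measure \<Rightarrow> 'a set \<Rightarrow> ('w \<Rightarrow> 'a ugraph) \<Rightarrow> 'b set \<Rightarrow> ('w \<Rightarrow> 'b ugraph) \<Rightarrow> bool" where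
  "indep_graphs M V R W S \<longleftrightarrow> prob_space.indep_set M (graph_sigma M V R) (graph_sigma M W S)"

end

theory Submission
  imports Defs "HOL-Real_Asymp.Real_Asymp"
begin

text \<open>
  In any simple graph, two distinct neighbours of \<open>i\<close> are at distance 1 or 2, since \<open>i\<close> joins
  them. Hence \<open>Eff(i) = 1/2 + 1/2 * t / (d (d - 1))\<close>, where \<open>d\<close> is the degree of \<open>i\<close> and \<open>t\<close>
  the number of ordered pairs of adjacent neighbours of \<open>i\<close>. Both \<open>d\<close> and \<open>t\<close> are
  multiplicative under the tensor product, so it suffices that almost surely \<open>d / n \<rightarrow> p\<close> and
  \<open>t / n\<^sup>2 \<rightarrow> p\<^sup>3\<close> in one random graph. Now \<open>t\<close> is the sum, over the neighbours \<open>k\<close> of \<open>u\<close>, of the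
  number of common neighbours of \<open>u\<close> and \<open>k\<close>. For a fixed \<open>k\<close> that number counts independent
  events of probability \<open>p\<^sup>2\<close>; by Hoeffding's inequality, a union bound over the \<open>n\<close> values of \<open>k\<close> and
  the Borel-Cantelli lemma it is \<open>p\<^sup>2 n + o(n)\<close> uniformly in \<open>k\<close>.
\<close>

section \<open>Uniform deviations of counts of independent events\<close>

text \<open>Both sides of the product formula expand to the product of \<open>prob (B l)\<close>
  over the disjoint union of the blocks \<open>L i\<close>. Blocks are nonempty because an empty
  intersection is \<open>UNIV\<close>, which need not be an event.\<close>

lemma (in prob_space) indep_events_INT:
  assumes indep: "indep_events B (\<Union>i\<in>I. L i)" and disj: "disjoint_family_on L I"
    and fin: "\<And>i. i \<in> I \<Longrightarrow> finite (L i)" and ne: "\<And>i. i \<in> I \<Longrightarrow> L i \<noteq> {}"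
  shows "indep_events (\<lambda>i. \<Inter>l\<in>L i. B l) I"
proof (rule indep_eventsI)
  fix i assume "i \<in> I"
  then show "(\<Inter>l\<in>L i. B l) \<in> events"
    using indep fin ne by (intro sets.finite_INT) (auto simp: indep_events_def image_subset_iff)
next
  fix J assume J: "J \<subseteq> I" "finite J" "J \<noteq> {}"
  have prob_INT: "prob (\<Inter>l\<in>T. B l) = (\<Prod>l\<in>T. prob (B l))"
    if "T \<subseteq> (\<Union>i\<in>I. L i)" "finite T" "T \<noteq> {}" for T
    using indep that by (simp add: indep_events_def)
  have "prob (\<Inter>i\<in>J. \<Inter>l\<in>L i. B l) = prob (\<Inter>l\<in>(\<Union>i\<in>J. L i). B l)"
    by (rule arg_cong[where f = prob]) auto
  also have "\<dots> = (\<Prod>l\<in>(\<Union>i\<in>J. L i). prob (B l))"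
  proof (rule prob_INT)
    show "(\<Union>i\<in>J. L i) \<noteq> {}"
      using J ne by fastforce
  qed (use J fin in auto)
  also have "\<dots> = (\<Prod>i\<in>J. \<Prod>l\<in>L i. prob (B l))"
  proof (rule prod.UNION_disjoint)
    show "\<forall>i\<in>J. \<forall>j\<in>J. i \<noteq> j \<longrightarrow> L i \<inter> L j = {}"
      using disj \<open>J \<subseteq> I\<close> by (meson disjoint_family_onD subsetD)
  qed (use J fin in auto)
  also have "\<dots> = (\<Prod>i\<in>J. prob (\<Inter>l\<in>L i. B l))"
    using J fin ne by (intro prod.cong refl prob_INT[symmetric]) auto
  finally show "prob (\<Inter>i\<in>J. \<Inter>l\<in>L i. B l) = (\<Prod>i\<in>J. prob (\<Inter>l\<in>L i. B l))" .
qed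

text \<open>The indicator of \<open>A i\<close> generates no more than the sigma-algebra of
  \<open>{A i}\<close>, and a single set is Int-stable, so independence passes from the events to
  these sigma-algebras. This is the form that Hoeffding's inequality takes.\<close>

lemma (in prob_space) indep_vars_indicator:
  assumes "indep_events A I"
  shows "indep_vars (\<lambda>_. borel) (\<lambda>i. indicator (A i) :: 'a \<Rightarrow> real) I"
proof -
  have ev: "A i \<in> events" if "i \<in> I" for i
    using assms that by (auto simp: indep_events_def)
  have "indep_sets (\<lambda>i. sigma_sets (space M) {A i}) I"
    using assms unfolding indep_events_def_alt
    by (rule indep_sets_sigma) (auto simp: Int_stable_def)
  then have "indep_sets
      (\<lambda>i. {(indicator (A i) :: 'a \<Rightarrow> real) -` B \<inter> space M | B. B \<in> sets borel}) I"
  proof (rule indep_sets_mono_sets)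
    fix i assume "i \<in> I"
    then have "A i \<subseteq> space M"
      using ev sets.sets_into_space by blast
    have "(indicator (A i) :: 'a \<Rightarrow> real) \<in> borel_measurable (sigma (space M) {A i})"
      using \<open>A i \<subseteq> space M\<close> by (intro borel_measurable_indicator) simp
    then show "{(indicator (A i) :: 'a \<Rightarrow> real) -` B \<inter> space M | B. B \<in> sets borel}
        \<subseteq> sigma_sets (space M) {A i}"
      using \<open>A i \<subseteq> space M\<close> by (auto dest!: measurable_sets)
  qed
  then show ?thesis
    using ev by (auto simp: indep_vars_def2)
qed

text \<open>Hoeffding's inequality for indicators gives the exponent
  \<open>- 2 * (\<epsilon> * n)\<^sup>2 / card I\<close>; replacing \<open>card I\<close> by the
  larger \<open>n\<close> only weakens the bound. The scale \<open>n\<close> serves index sets that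
  miss a few of \<open>n\<close> vertices.\<close>

lemma (in prob_space) prob_card_deviation_le:
  fixes \<epsilon> q :: real and n :: nat
  assumes "finite I" "indep_events A I" "\<And>i. i \<in> I \<Longrightarrow> prob (A i) = q"
    and "card I \<le> n" "\<epsilon> > 0"
  shows "prob {x \<in> space M. \<epsilon> * n \<le> \<bar>card {i \<in> I. x \<in> A i} - q * card I\<bar>}
    \<le> 2 * exp (- 2 * \<epsilon>\<^sup>2 * n)"
\<comment> \<open>Hoeffding's exponent divides by \<open>card I\<close>. For \<open>n = 0\<close>
  the claimed bound is 2; for empty \<open>I\<close> and \<open>n > 0\<close> the deviation is 0,
  which is below \<open>\<epsilon> * n\<close>.\<close>
proof (cases "card I = 0 \<or> n = 0")
  case True
  show ?thesis
  proof (cases "n = 0")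
    case True
    then show ?thesis
      by (auto intro: order_trans[OF prob_le_1])
  next
    case False
    then have "{x \<in> space M. \<epsilon> * n \<le> \<bar>card {i \<in> I. x \<in> A i} - q * card I\<bar>} = {}"
      using \<open>card I = 0 \<or> n = 0\<close> \<open>finite I\<close> \<open>\<epsilon> > 0\<close> by (auto simp: not_le)
    then show ?thesis
      by (simp only: measure_empty) simp
  qed
next
  case False
  have ev: "A i \<in> events" if "i \<in> I" for i
    using assms that by (auto simp: indep_events_def)
  have mean: "(\<Sum>i\<in>I. expectation (indicator (A i))) = q * card I"
    using assms(3) ev by simp
  interpret Hoeffding_ineq M I "\<lambda>i. indicator (A i)" "\<lambda>_. 0" "\<lambda>_. 1"
    "\<Sum>i\<in>I. expectation (indicator (A i))"
  proof unfold_locales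
    show "finite I"
      by (rule assms(1))
    show "indep_vars (\<lambda>_. borel) (\<lambda>i. indicator (A i) :: 'a \<Rightarrow> real) I"
      using assms(2) by (rule indep_vars_indicator)
    show "AE x in M. (indicator (A i) x :: real) \<in> {0..1}" for i
      by (simp add: indicator_def)
  qed
  have count: "(\<Sum>i\<in>I. indicator (A i) x) = real (card {i \<in> I. x \<in> A i})" for x
    using \<open>finite I\<close> by (simp add: indicator_def sum.If_cases Int_def)
  have "prob {x \<in> space M. \<epsilon> * n \<le> \<bar>card {i \<in> I. x \<in> A i} - q * card I\<bar>}
      \<le> 2 * exp (- 2 * (\<epsilon> * n)\<^sup>2 / card I)"
    using Hoeffding_ineq_abs_ge[of "\<epsilon> * n"] False \<open>\<epsilon> > 0\<close>
    unfolding count mean by simp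
  also have "\<dots> \<le> 2 * exp (- 2 * (\<epsilon> * n)\<^sup>2 / n)"
    using False \<open>card I \<le> n\<close> by (auto intro!: divide_left_mono)
  also have "\<dots> = 2 * exp (- 2 * \<epsilon>\<^sup>2 * n)"
    using False by (simp add: power2_eq_square)
  finally show ?thesis .
qed

text \<open>At most \<open>Suc n\<close> bad events occur at stage \<open>n\<close>, each
  exponentially unlikely, so the probabilities of their unions are summable and Borel-Cantelli
  applies.\<close>

lemma (in prob_space) AE_eventually_card_deviation_less:
  fixes A :: "nat \<Rightarrow> 'k \<Rightarrow> 'i \<Rightarrow> 'a set" and \<epsilon> q :: real
  assumes "\<And>n. finite (K n)" "\<And>n. card (K n) \<le> Suc n"
    and "\<And>n k. k \<in> K n \<Longrightarrow> finite (I n k)" "\<And>n k. k \<in> K n \<Longrightarrow> card (I n k) \<le> n"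
    and "\<And>n k. k \<in> K n \<Longrightarrow> indep_events (A n k) (I n k)"
    and "\<And>n k i. k \<in> K n \<Longrightarrow> i \<in> I n k \<Longrightarrow> prob (A n k i) = q"
    and "\<epsilon> > 0"
  shows "AE x in M. \<forall>\<^sub>F n in sequentially. \<forall>k \<in> K n.
    \<bar>card {i \<in> I n k. x \<in> A n k i} - q * card (I n k)\<bar> < \<epsilon> * n"
proof -
  define D where
    "D n k = {x \<in> space M. \<epsilon> * n \<le> \<bar>card {i \<in> I n k. x \<in> A n k i} - q * card (I n k)\<bar>}" for n k
  have D_sets: "D n k \<in> events" if "k \<in> K n" for n k
  proof -
    have [measurable]: "A n k i \<in> events" if "i \<in> I n k" for i
      using assms(5)[OF \<open>k \<in> K n\<close>] that by (auto simp: indep_events_def)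
    have "(\<lambda>x. \<Sum>i\<in>I n k. indicator (A n k i) x :: real) \<in> borel_measurable M"
      by measurable
    moreover have "(\<Sum>i\<in>I n k. indicator (A n k i) x) = real (card {i \<in> I n k. x \<in> A n k i})" for x
      using assms(3)[OF that] by (simp add: indicator_def sum.If_cases Int_def)
    ultimately have [measurable]: "(\<lambda>x. real (card {i \<in> I n k. x \<in> A n k i})) \<in> borel_measurable M"
      by simp
    show ?thesis
      unfolding D_def by measurable
  qed
  define c where "c = exp (- 2 * \<epsilon>\<^sup>2)"
  have "prob (\<Union>k\<in>K n. D n k) \<le> 2 * (real (Suc n) * c ^ n)" for n
  proof -
    have "prob (\<Union>k\<in>K n. D n k) \<le> (\<Sum>k\<in>K n. prob (D n k))"
      using assms(1) D_sets by (intro measure_UNION_le) auto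
    also have "\<dots> \<le> (\<Sum>k\<in>K n. 2 * exp (- 2 * \<epsilon>\<^sup>2 * n))"
      unfolding D_def using assms by (intro sum_mono prob_card_deviation_le) auto
    also have "\<dots> \<le> real (Suc n) * (2 * exp (- 2 * \<epsilon>\<^sup>2 * n))"
      using assms(2)[of n] by (auto intro!: mult_right_mono)
    also have "exp (- 2 * \<epsilon>\<^sup>2 * n) = c ^ n"
      by (simp add: c_def exp_of_nat_mult[symmetric] mult_ac)
    finally show ?thesis
      by simp
  qed
  then have "\<forall>n\<ge>0. norm (prob (\<Union>k\<in>K n. D n k)) \<le> 2 * (real (Suc n) * c ^ n)"
    by (simp only: real_norm_def abs_of_nonneg measure_nonneg) simp
  \<comment> \<open>The factor \<open>Suc n\<close> makes this twice the termwise derivative of a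
    geometric series.\<close>
  moreover have "summable (\<lambda>n. 2 * (real (Suc n) * c ^ n))"
  proof (intro summable_mult sums_summable[OF geometric_deriv_sums])
    show "norm c < 1"
      using \<open>\<epsilon> > 0\<close> by (simp add: c_def)
  qed
  ultimately have sum: "summable (\<lambda>n. prob (\<Union>k\<in>K n. D n k))"
    by (rule summable_comparison_test[OF exI])
  have "AE x in M. \<forall>\<^sub>F n in sequentially. x \<in> space M - (\<Union>k\<in>K n. D n k)"
  proof (rule borel_cantelli_AE1[OF _ _ sum])
    show "(\<Union>k\<in>K n. D n k) \<in> events" for n
      using assms(1) D_sets by (intro sets.finite_UN)
    show "emeasure M (\<Union>k\<in>K n. D n k) < \<infinity>" for n
      by (simp add: less_top[symmetric])
  qed
  then show ?thesis
  proof eventually_elim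
    case (elim x)
    then show ?case
      by (rule eventually_mono) (auto simp: D_def not_le)
  qed
qed

text \<open>The exceptional null set may depend on \<open>\<epsilon>\<close>; restricting to the
  countably many values \<open>1 / (m + 1)\<close> yields one null set for all.\<close>

lemma AE_tendsto_zeroI:
  fixes f :: "'a \<Rightarrow> nat \<Rightarrow> real"
  assumes "\<And>\<epsilon>. \<epsilon> > 0 \<Longrightarrow> AE x in M. \<forall>\<^sub>F n in sequentially. \<bar>f x n\<bar> < \<epsilon>"
  shows "AE x in M. f x \<longlonglongrightarrow> 0"
proof -
  have "AE x in M. \<forall>m. \<forall>\<^sub>F n in sequentially. \<bar>f x n\<bar> < inverse (real (Suc m))"
    by (subst AE_all_countable) (simp add: assms)
  then show ?thesis
  proof eventually_elim
    case (elim x)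
    show ?case
    proof (rule tendstoI)
      fix e :: real assume "e > 0"
      then obtain m where "inverse (real (Suc m)) < e"
        using reals_Archimedean by blast
      with elim[rule_format, of m] show "\<forall>\<^sub>F n in sequentially. dist (f x n) 0 < e"
        by (auto elim: eventually_mono)
    qed
  qed
qed

section \<open>Local efficiency of tensor products\<close>

text \<open>Pairs are ordered so that their number multiplies under the tensor product; an edge of
  each factor yields two unordered edges of the product.\<close>

definition nbr_links :: "'a ugraph \<Rightarrow> 'a \<Rightarrow> ('a \<times> 'a) set" where
  "nbr_links F i = {(j, k). j \<in> nbrs F i \<and> k \<in> nbrs F i \<and> {j, k} \<in> edges F}"

lemma edge_verts:
  assumes "simple_graph F" "{a, b} \<in> edges F"
  shows "a \<in> verts F" "b \<in> verts F" "a \<noteq> b"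
proof -
  have "{a, b} \<in> [verts F]\<^bsup>2\<^esup>"
    using assms unfolding simple_graph_def by blast
  then have "a \<in> verts F \<and> b \<in> verts F \<and> a \<noteq> b"
    by (rule doubleton_in_nsets_2[THEN iffD1])
  then show "a \<in> verts F" "b \<in> verts F" "a \<noteq> b"
    by blast+
qed

section \<open>Distances between neighbours of a vertex\<close>

lemma inv_dist_adjacent:
  assumes "simple_graph F" "{a, b} \<in> edges F"
  shows "inv_dist F a b = 1"
proof -
  have "walk F a [a, b] b"
    using assms edge_verts[OF assms] by (simp add: walk_def)
  then have "gdist F a b \<le> 1"
    unfolding gdist_def by (intro INF_lower2[of "[a, b]"]) (auto simp: one_enat_def)
  moreover have "1 \<le> gdist F a b"
    unfolding gdist_def
  proof (rule INF_greatest, simp)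
    fix xs assume "walk F a xs b"
    \<comment> \<open>A walk lists its vertices, one more than its steps; a single vertex would
      force \<open>a = b\<close>.\<close>
    then have "length xs \<noteq> 0" "length xs \<noteq> 1"
      using edge_verts(3)[OF assms] by (auto simp: walk_def length_Suc_conv)
    then have "1 \<le> length xs - Suc 0"
      by linarith
    then show "1 \<le> enat (length xs - Suc 0)"
      by (simp add: one_enat_def)
  qed
  ultimately have "gdist F a b = 1"
    by simp
  then show ?thesis
    by (simp add: inv_dist_def one_enat_def)
qed

text \<open>The walk through \<open>i\<close> has two steps, and a shorter one would need
  \<open>a = b\<close> or an edge between them.\<close>

lemma inv_dist_common_neighbour:
  assumes "simple_graph F" "{i, a} \<in> edges F" "{i, b} \<in> edges F" "a \<noteq> b" "{a, b} \<notin> edges F"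
  shows "inv_dist F a b = 1 / 2"
proof -
  have "walk F a [a, i, b] b"
    using assms edge_verts[OF assms(1)] by (simp add: walk_def insert_commute)
  then have "gdist F a b \<le> enat 2"
    unfolding gdist_def by (intro INF_lower2[of "[a, i, b]"]) auto
  moreover have "enat 2 \<le> gdist F a b"
    unfolding gdist_def
  proof (rule INF_greatest, simp)
    fix xs assume "walk F a xs b"
    then have "length xs \<noteq> 0" "length xs \<noteq> 1" "length xs \<noteq> 2"
      using \<open>a \<noteq> b\<close> \<open>{a, b} \<notin> edges F\<close>
      by (auto simp: walk_def length_Suc_conv numeral_2_eq_2)
    then show "2 \<le> length xs - Suc 0"
      by linarith
  qed
  ultimately have "gdist F a b = enat 2"
    by (rule antisym)
  then show ?thesis
    by (simp add: inv_dist_def)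
qed

text \<open>Without loops, the ordered pairs split into fibres over the edges inside the
  neighbourhood, each consisting of the two orderings of one edge.\<close>

lemma card_nbr_links:
  assumes "simple_graph F" "finite (nbrs F i)"
  shows "card (nbr_links F i) = 2 * card ([nbrs F i]\<^bsup>2\<^esup> \<inter> edges F)"
proof -
  have "nbr_links F i = (\<Union>e \<in> [nbrs F i]\<^bsup>2\<^esup> \<inter> edges F. {(j, k). {j, k} = e})"
    using edge_verts[OF assms(1)] by (auto simp: nbr_links_def)
  also have "card \<dots> = (\<Sum>e \<in> [nbrs F i]\<^bsup>2\<^esup> \<inter> edges F. card {(j, k). {j, k} = e})"
  proof (rule card_UN_disjoint)
    show "\<forall>e \<in> [nbrs F i]\<^bsup>2\<^esup> \<inter> edges F. finite {(j, k). {j, k} = e}"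
    proof
      fix e assume "e \<in> [nbrs F i]\<^bsup>2\<^esup> \<inter> edges F"
      then have "finite (e \<times> e)"
        by (auto simp: nsets_def)
      then show "finite {(j, k). {j, k} = e}"
        by (rule rev_finite_subset) auto
    qed
  qed (auto simp: assms(2) finite_imp_finite_nsets)
  also have "\<dots> = (\<Sum>e \<in> [nbrs F i]\<^bsup>2\<^esup> \<inter> edges F. 2)"
  proof (rule sum.cong)
    fix e assume "e \<in> [nbrs F i]\<^bsup>2\<^esup> \<inter> edges F"
    then obtain a b where "e = {a, b}" "a \<noteq> b"
      by (auto simp: nsets_2_eq)
    then have "{(j, k). {j, k} = e} = {(a, b), (b, a)}"
      by (auto simp: doubleton_eq_iff)
    then show "card {(j, k). {j, k} = e} = 2"
      using \<open>a \<noteq> b\<close> by simp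
  qed simp
  finally show ?thesis
    by simp
qed

lemma local_efficiency_eq:
  assumes "simple_graph F" "finite (nbrs F i)" "vdeg F i \<ge> 2"
  shows "local_efficiency F i
    = 1 / 2 + 1 / 2 * (card (nbr_links F i) / (real (vdeg F i) * (real (vdeg F i) - 1)))"
proof -
  define N where "N = nbrs F i"
  define d where "d = vdeg F i"
  have fin: "finite ([N]\<^bsup>2\<^esup>)"
    using assms(2) by (simp add: N_def finite_imp_finite_nsets)
  have pairs: "card ([N]\<^bsup>2\<^esup>) = d choose 2"
    by (simp add: N_def d_def vdeg_def)
  have dc: "real (d choose 2) = real d * (real d - 1) / 2"
    using assms(3) by (simp add: d_def choose_two real_of_nat_div of_nat_diff)
  have "(\<Sum>e\<in>[N]\<^bsup>2\<^esup>. THE r. \<forall>j k. e = {j, k} \<longrightarrow> r = inv_dist F j k)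
      = (\<Sum>e\<in>[N]\<^bsup>2\<^esup>. 1 / 2 + (if e \<in> edges F then 1 / 2 else 0))"
  proof (rule sum.cong)
    fix e assume "e \<in> [N]\<^bsup>2\<^esup>"
    then obtain a b where "e = {a, b}" "a \<noteq> b" "{i, a} \<in> edges F" "{i, b} \<in> edges F"
      by (auto simp: nsets_2_eq N_def nbrs_def)
    then show "(THE r. \<forall>j k. e = {j, k} \<longrightarrow> r = inv_dist F j k)
        = 1 / 2 + (if e \<in> edges F then 1 / 2 else 0)"
      using assms(1)
      by (simp only: inv_dist_unordered) (auto simp: inv_dist_adjacent inv_dist_common_neighbour)
  qed simp
  \<comment> \<open>Half of the ordered links are unordered adjacent pairs, and each of these adds
    1/2; hence the quarter.\<close>
  also have "\<dots> = real (d choose 2) / 2 + card (nbr_links F i) / 4"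
    using fin card_nbr_links[OF assms(1,2)]
    by (simp add: sum.distrib sum.If_cases N_def d_def vdeg_def)
  finally have "local_efficiency F i
      = inverse (real (d choose 2)) * (real (d choose 2) / 2 + card (nbr_links F i) / 4)"
    by (simp add: local_efficiency_def N_def d_def)
  moreover have "real d * (real d - 1) \<noteq> 0"
    using assms(3) by (simp add: d_def)
  ultimately show ?thesis
    unfolding dc d_def[symmetric] by (simp add: distrib_left field_simps del: mult_eq_0_iff)
qed

section \<open>Multiplicativity under the tensor product\<close>

lemma tensor_product_edge_iff:
  "{(a, b), (a', b')} \<in> edges (tensor_product G H) \<longleftrightarrow> {a, a'} \<in> edges G \<and> {b, b'} \<in> edges H"
  \<comment> \<open>Reading the edge from its other end swaps both coordinates at once and leaves
    \<open>{a, a'}\<close> and \<open>{b, b'}\<close> unchanged.\<close>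
  by (auto simp: tensor_product_def doubleton_eq_iff insert_commute)

lemma nbrs_tensor_product:
  "nbrs (tensor_product G H) (u, v) = nbrs G u \<times> nbrs H v"
  by (auto simp: nbrs_def tensor_product_edge_iff)

lemma vdeg_tensor_product:
  "vdeg (tensor_product G H) (u, v) = vdeg G u * vdeg H v"
  by (simp add: vdeg_def nbrs_tensor_product card_cartesian_product)

lemma card_nbr_links_tensor_product:
  "card (nbr_links (tensor_product G H) (u, v)) = card (nbr_links G u) * card (nbr_links H v)"
proof -
  have "nbr_links (tensor_product G H) (u, v)
      = (\<lambda>((a, a'), (b, b')). ((a, b), (a', b'))) ` (nbr_links G u \<times> nbr_links H v)"
    by (force simp: nbr_links_def nbrs_tensor_product tensor_product_edge_iff image_iff)
  moreover have "inj_on (\<lambda>((a, a'), (b, b')). ((a, b), (a', b')))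
      (nbr_links G u \<times> nbr_links H v)"
    by (auto simp: inj_on_def)
  ultimately show ?thesis
    by (simp add: card_image card_cartesian_product)
qed

text \<open>This is the deterministic half: the degree grows like
  \<open>p\<^sup>2 * n\<^sup>2\<close> and the links like \<open>p ^ 6 * n ^ 4\<close>, so the ratio
  in \<open>local_efficiency_eq\<close> tends to \<open>p ^ 6 / p ^ 4\<close>.\<close>

lemma local_efficiency_tensor_product_tendsto:
  fixes G :: "nat \<Rightarrow> 'a ugraph" and H :: "nat \<Rightarrow> 'b ugraph"
  assumes "0 < p"
    and G: "\<And>n. simple_graph (G n)" "\<And>n. finite (nbrs (G n) u)"
      "(\<lambda>n. vdeg (G n) u / n) \<longlonglongrightarrow> p" "(\<lambda>n. card (nbr_links (G n) u) / (real n)\<^sup>2) \<longlonglongrightarrow> p ^ 3"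
    and H: "\<And>n. simple_graph (H n)" "\<And>n. finite (nbrs (H n) v)"
      "(\<lambda>n. vdeg (H n) v / n) \<longlonglongrightarrow> p" "(\<lambda>n. card (nbr_links (H n) v) / (real n)\<^sup>2) \<longlonglongrightarrow> p ^ 3"
  shows "(\<lambda>n. local_efficiency (tensor_product (G n) (H n)) (u, v)) \<longlonglongrightarrow> 1 / 2 + 1 / 2 * p\<^sup>2"
proof -
  define d where "d n = real (vdeg (G n) u) * real (vdeg (H n) v)" for n
  define t where "t n = real (card (nbr_links (G n) u)) * real (card (nbr_links (H n) v))" for n
  have d_lim: "(\<lambda>n. d n / (real n)\<^sup>2) \<longlonglongrightarrow> p\<^sup>2"
    using tendsto_mult[OF G(3) H(3)] by (simp add: d_def power2_eq_square)
  have t_lim: "(\<lambda>n. t n / real n ^ 4) \<longlonglongrightarrow> p ^ 6"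
    using tendsto_mult[OF G(4) H(4)] by (simp add: t_def power_add[symmetric])
  have inv_lim: "(\<lambda>n. 1 / (real n)\<^sup>2) \<longlonglongrightarrow> 0"
    by real_asymp
  have "(\<lambda>n. (t n / real n ^ 4) / ((d n / (real n)\<^sup>2) * (d n / (real n)\<^sup>2 - 1 / (real n)\<^sup>2))) \<longlonglongrightarrow> p ^ 6 / (p\<^sup>2 * (p\<^sup>2 - 0))"
    using \<open>0 < p\<close> by (intro tendsto_intros d_lim t_lim inv_lim) auto
  also have "p ^ 6 / (p\<^sup>2 * (p\<^sup>2 - 0)) = p\<^sup>2"
    using \<open>0 < p\<close> by (simp add: field_simps flip: power_add)
  finally have lim: "(\<lambda>n. 1 / 2 + 1 / 2 * ((t n / real n ^ 4) / ((d n / (real n)\<^sup>2) * (d n / (real n)\<^sup>2 - 1 / (real n)\<^sup>2))))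
      \<longlonglongrightarrow> 1 / 2 + 1 / 2 * p\<^sup>2"
    by (intro tendsto_intros)
  \<comment> \<open>Positivity forces \<open>d n > 1\<close>, hence degree at least 2, where the
    exact formula holds. It also excludes \<open>n = 0\<close>, where both quotients are 0.\<close>
  have "\<forall>\<^sub>F n in sequentially. 0 < d n / (real n)\<^sup>2 - 1 / (real n)\<^sup>2"
    using tendsto_diff[OF d_lim inv_lim] \<open>0 < p\<close> by (intro order_tendstoD(1)[where y = "p\<^sup>2"]) auto
  then have "\<forall>\<^sub>F n in sequentially.
      1 / 2 + 1 / 2 * ((t n / real n ^ 4) / ((d n / (real n)\<^sup>2) * (d n / (real n)\<^sup>2 - 1 / (real n)\<^sup>2)))
      = local_efficiency (tensor_product (G n) (H n)) (u, v)"
  proof eventually_elim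
    fix n :: nat assume *: "0 < d n / (real n)\<^sup>2 - 1 / (real n)\<^sup>2"
    then have "n > 0"
      by (cases "n = 0") auto
    from * have "d n > 1"
      by (simp add: diff_divide_distrib[symmetric] zero_less_divide_iff)
    then have "real (vdeg (tensor_product (G n) (H n)) (u, v)) > 1"
      by (simp add: vdeg_tensor_product d_def)
    then have "vdeg (tensor_product (G n) (H n)) (u, v) \<ge> 2"
      by simp
    moreover have "simple_graph (tensor_product (G n) (H n))"
      using G(1) H(1) by (rule simple_graph_tensor_product)
    moreover have "finite (nbrs (tensor_product (G n) (H n)) (u, v))"
      using G(2) H(2) by (simp add: nbrs_tensor_product)
    ultimately have "local_efficiency (tensor_product (G n) (H n)) (u, v)
        = 1 / 2 + 1 / 2 * (t n / (d n * (d n - 1)))"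
      by (simp add: local_efficiency_eq vdeg_tensor_product card_nbr_links_tensor_product t_def d_def)
    also have "t n / (d n * (d n - 1))
        = (t n / real n ^ 4) / ((d n / (real n)\<^sup>2) * (d n / (real n)\<^sup>2 - 1 / (real n)\<^sup>2))"
    proof -
      have "(d n / (real n)\<^sup>2) * (d n / (real n)\<^sup>2 - 1 / (real n)\<^sup>2) = d n * (d n - 1) / real n ^ 4"
        using \<open>n > 0\<close> by (simp add: field_simps flip: power_add)
      then show ?thesis
        using \<open>n > 0\<close> by simp
    qed
    finally show "1 / 2 + 1 / 2 * ((t n / real n ^ 4)
          / ((d n / (real n)\<^sup>2) * (d n / (real n)\<^sup>2 - 1 / (real n)\<^sup>2)))
        = local_efficiency (tensor_product (G n) (H n)) (u, v)"
      by simp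
  qed
  with lim show ?thesis
    by (rule Lim_transform_eventually)
qed

section \<open>Neighbourhoods in Erdos-Renyi graphs\<close>

text \<open>The event for \<open>j\<close> involves only the edges from \<open>j\<close> to
  \<open>K\<close>. For distinct \<open>j\<close> outside \<open>K\<close> these edge sets are
  disjoint, and each has exactly \<open>card K\<close> elements.\<close>

lemma (in prob_space) erdos_renyi_common_neighbour_events:
  assumes er: "erdos_renyi M V p R" and K: "finite K" "K \<noteq> {}" "K \<subseteq> V" and I: "I \<subseteq> V - K"
  shows "indep_events (\<lambda>j. \<Inter>k\<in>K. edge_event M R {k, j}) I"
    and "j \<in> I \<Longrightarrow> prob (\<Inter>k\<in>K. edge_event M R {k, j}) = p ^ card K"
proof -
  define L where "L j = (\<lambda>k. {k, j}) ` K" for j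
  have L_edges: "L j \<subseteq> [V]\<^bsup>2\<^esup>" if "j \<in> I" for j
    using that K I by (auto simp: L_def simp del: nsets_doubleton_2_eq)
  have indep: "indep_events (edge_event M R) ([V]\<^bsup>2\<^esup>)"
    and prob: "\<And>e. e \<in> [V]\<^bsup>2\<^esup> \<Longrightarrow> prob (edge_event M R e) = p"
    using er by (auto simp: erdos_renyi_def)
  have INT_L: "(\<Inter>l\<in>L j. edge_event M R l) = (\<Inter>k\<in>K. edge_event M R {k, j})" for j
    by (simp add: L_def)
  have "indep_events (\<lambda>j. \<Inter>l\<in>L j. edge_event M R l) I"
  proof (rule indep_events_INT)
    show "indep_events (edge_event M R) (\<Union>j\<in>I. L j)"
      using indep unfolding indep_events_def_alt
      by (rule indep_sets_mono_index[rotated]) (use L_edges in auto)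
    show "disjoint_family_on L I"
      using I by (fastforce simp: disjoint_family_on_def L_def doubleton_eq_iff)
  qed (use K in \<open>auto simp: L_def\<close>)
  then show "indep_events (\<lambda>j. \<Inter>k\<in>K. edge_event M R {k, j}) I"
    by (simp add: INT_L)
  assume "j \<in> I"
  have "prob (\<Inter>l\<in>L j. edge_event M R l) = (\<Prod>l\<in>L j. prob (edge_event M R l))"
    using indep[unfolded indep_events_def, THEN conjunct2, rule_format, OF L_edges[OF \<open>j \<in> I\<close>]] K
    by (simp add: L_def)
  also have "\<dots> = (\<Prod>l\<in>L j. p)"
    using L_edges[OF \<open>j \<in> I\<close>] prob by (intro prod.cong) auto
  also have "\<dots> = p ^ card K"
    using \<open>j \<in> I\<close> I by (auto simp: L_def card_image inj_on_def doubleton_eq_iff)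
  finally show "prob (\<Inter>k\<in>K. edge_event M R {k, j}) = p ^ card K"
    by (simp only: INT_L)
qed

text \<open>The cases \<open>K = {u}\<close> and \<open>K = {u, k}\<close> treat degrees and links
  uniformly; the candidates \<open>S - K\<close> match the index set of the independent
  events.\<close>

definition common_nbrs :: "'a ugraph \<Rightarrow> 'a set \<Rightarrow> 'a set \<Rightarrow> 'a set" where
  "common_nbrs F S K = {j \<in> S - K. \<forall>k\<in>K. {k, j} \<in> edges F}"

lemma (in prob_space) erdos_renyi_common_nbrs_AE:
  fixes R :: "'a \<Rightarrow> nat ugraph" and \<epsilon> :: real
  assumes er: "erdos_renyi M {1..} p R"
    and KK: "\<And>n. finite (KK n)" "\<And>n. card (KK n) \<le> Suc n"
    and K: "\<And>n K. K \<in> KK n \<Longrightarrow> K \<subseteq> {1..n}" "\<And>n K. K \<in> KK n \<Longrightarrow> card K = r"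
    and "r > 0" "\<epsilon> > 0"
  shows "AE \<omega> in M. \<forall>\<^sub>F n in sequentially. \<forall>K \<in> KK n.
    \<bar>card (common_nbrs (R \<omega>) {1..n} K) - p ^ r * (real n - real r)\<bar> < \<epsilon> * n"
proof -
  have fin: "finite K" "K \<noteq> {}" if "K \<in> KK n" for n K
    using K[OF that] \<open>r > 0\<close> by (auto intro: finite_subset)
  \<comment> \<open>The bound \<open>r \<le> n\<close> turns truncated subtraction into the real
    difference \<open>real n - real r\<close>.\<close>
  have card_diff: "card ({1..n} - K) = n - r" "r \<le> n" if "K \<in> KK n" for n K
    using K[OF that] card_mono[of "{1..n}" K] by (auto simp: card_Diff_subset finite_subset)
  have "AE \<omega> in M. \<forall>\<^sub>F n in sequentially. \<forall>K \<in> KK n.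
    \<bar>card {j \<in> {1..n} - K. \<omega> \<in> (\<Inter>k\<in>K. edge_event M R {k, j})}
      - p ^ r * card ({1..n} - K)\<bar> < \<epsilon> * n"
  proof (rule AE_eventually_card_deviation_less[OF KK _ _ _ _ \<open>\<epsilon> > 0\<close>])
    fix n K assume "K \<in> KK n"
    note ev = erdos_renyi_common_neighbour_events[OF er fin[OF this], of "{1..n} - K"]
    show "indep_events (\<lambda>j. \<Inter>k\<in>K. edge_event M R {k, j}) ({1..n} - K)"
      using K(1)[OF \<open>K \<in> KK n\<close>] by (intro ev) auto
    show "prob (\<Inter>k\<in>K. edge_event M R {k, j}) = p ^ r" if "j \<in> {1..n} - K" for j
      using K[OF \<open>K \<in> KK n\<close>] that ev(2)[of j] by fastforce
    show "card ({1..n} - K) \<le> n"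
      using card_diff[OF \<open>K \<in> KK n\<close>] by simp
  qed simp
  with AE_space show ?thesis
  proof eventually_elim
    case (elim \<omega>)
    from elim(2) show ?case
    proof (rule eventually_mono, intro ballI)
      fix n K assume *: "\<forall>K \<in> KK n. \<bar>card {j \<in> {1..n} - K. \<omega> \<in> (\<Inter>k\<in>K. edge_event M R {k, j})}
        - p ^ r * card ({1..n} - K)\<bar> < \<epsilon> * n" and "K \<in> KK n"
      have "{j \<in> {1..n} - K. \<omega> \<in> (\<Inter>k\<in>K. edge_event M R {k, j})} = common_nbrs (R \<omega>) {1..n} K"
        using elim(1) by (auto simp: common_nbrs_def edge_event_def)
      with *[rule_format, OF \<open>K \<in> KK n\<close>] card_diff[OF \<open>K \<in> KK n\<close>]
      show "\<bar>card (common_nbrs (R \<omega>) {1..n} K) - p ^ r * (real n - real r)\<bar> < \<epsilon> * n"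
        by (simp add: of_nat_diff)
    qed
  qed
qed

section \<open>Degrees and links through common neighbours, and their almost sure limits\<close>

lemma vdeg_induced:
  assumes "simple_graph F" "u \<in> {1..n}"
  shows "vdeg (induced F {1..n}) u = card (common_nbrs F {1..n} {u})"
proof -
  have "nbrs (induced F {1..n}) u = common_nbrs F {1..n} {u}"
    using assms edge_verts(3)[OF assms(1)]
    by (auto simp: nbrs_def induced_def common_nbrs_def)
  then show ?thesis
    by (simp add: vdeg_def)
qed

lemma finite_nbrs_induced: "finite S \<Longrightarrow> finite (nbrs (induced F S) u)"
  by (rule finite_subset[of _ S]) (auto simp: nbrs_def induced_def)

lemma card_nbr_links_induced:
  assumes "simple_graph F" "finite S"
  shows "card (nbr_links (induced F S) u) = (\<Sum>k\<in>nbrs (induced F S) u. card (common_nbrs F S {u, k}))"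
proof -
  \<comment> \<open>With the first endpoint \<open>k\<close> fixed, the second ranges over the
    common neighbours of \<open>u\<close> and \<open>k\<close>; as there are no loops, it differs
    from both.\<close>
  have "nbr_links (induced F S) u = (SIGMA k:nbrs (induced F S) u. common_nbrs F S {u, k})"
    using edge_verts(3)[OF assms(1)]
    by (auto simp: nbr_links_def nbrs_def induced_def common_nbrs_def)
  then show ?thesis
    using assms(2) by (simp add: finite_nbrs_induced common_nbrs_def)
qed

lemma (in prob_space) erdos_renyi_vdeg_AE:
  fixes R :: "'a \<Rightarrow> nat ugraph"
  assumes er: "erdos_renyi M {1..} p R" and "u \<ge> 1"
  shows "AE \<omega> in M. (\<lambda>n. vdeg (induced (R \<omega>) {1..n}) u / n) \<longlonglongrightarrow> p"
proof -
  have "AE \<omega> in M. (\<lambda>n. (vdeg (induced (R \<omega>) {1..n}) u - p * (real n - 1)) / n) \<longlonglongrightarrow> 0"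
  proof (rule AE_tendsto_zeroI)
    fix \<epsilon> :: real assume "\<epsilon> > 0"
    \<comment> \<open>Intersecting with \<open>Pow {1..n}\<close> empties the family while
      \<open>n < u\<close>, so its members lie in \<open>{1..n}\<close> for every
      \<open>n\<close>.\<close>
    have "card ({{u}} \<inter> Pow {1..n}) \<le> Suc n" for n
      using card_mono[of "{{u}}" "{{u}} \<inter> Pow {1..n}"] by simp
    then have "AE \<omega> in M. \<forall>\<^sub>F n in sequentially. \<forall>K \<in> {{u}} \<inter> Pow {1..n}.
        \<bar>card (common_nbrs (R \<omega>) {1..n} K) - p ^ 1 * (real n - real 1)\<bar> < \<epsilon> * n"
      using \<open>\<epsilon> > 0\<close> by (intro erdos_renyi_common_nbrs_AE[OF er]) auto
    with AE_space show "AE \<omega> in M. \<forall>\<^sub>F n in sequentially.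
        \<bar>(vdeg (induced (R \<omega>) {1..n}) u - p * (real n - 1)) / n\<bar> < \<epsilon>"
    proof eventually_elim
      case (elim \<omega>)
      then have "simple_graph (R \<omega>)"
        using er by (simp add: erdos_renyi_def)
      from elim(2) eventually_ge_at_top[of u] show ?case
      proof eventually_elim
        case (elim n)
        then have "u \<in> {1..n}"
          using \<open>u \<ge> 1\<close> by simp
        with elim vdeg_induced[OF \<open>simple_graph (R \<omega>)\<close> this] show ?case
          by (simp add: field_simps)
      qed
    qed
  qed
  then show ?thesis
  proof eventually_elim
    case (elim \<omega>)
    have "(\<lambda>n. p * (real n - 1) / n) \<longlonglongrightarrow> p"
      by real_asymp
    from tendsto_add[OF elim this] show ?case
      by (simp add: diff_divide_distrib)
  qed
qed

text \<open>The links are a sum of common-neighbour counts over a random neighbourhood, so these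
  counts are controlled uniformly over all possible \<open>k\<close>; the limit is
  \<open>p\<^sup>2\<close> times the limit \<open>p\<close> of the normalised degree.\<close>

lemma (in prob_space) erdos_renyi_nbr_links_AE:
  fixes R :: "'a \<Rightarrow> nat ugraph"
  assumes er: "erdos_renyi M {1..} p R" and "u \<ge> 1"
  shows "AE \<omega> in M. (\<lambda>n. card (nbr_links (induced (R \<omega>) {1..n}) u) / (real n)\<^sup>2) \<longlonglongrightarrow> p ^ 3"
proof -
  define d where "d \<omega> n = real (vdeg (induced (R \<omega>) {1..n}) u)" for \<omega> n
  define t where "t \<omega> n = real (card (nbr_links (induced (R \<omega>) {1..n}) u))" for \<omega> n
  have "AE \<omega> in M. (\<lambda>n. (t \<omega> n - p\<^sup>2 * (real n - 2) * d \<omega> n) / (real n)\<^sup>2) \<longlonglongrightarrow> 0"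
  proof (rule AE_tendsto_zeroI)
    fix \<epsilon> :: real assume "\<epsilon> > 0"
    define KK where "KK n = {K \<in> (\<lambda>k. {u, k}) ` ({1..n} - {u}). K \<subseteq> {1..n}}" for n
    have "card (KK n) \<le> Suc n" for n
    proof -
      have "card (KK n) \<le> card ((\<lambda>k. {u, k}) ` ({1..n} - {u}))"
        unfolding KK_def by (intro card_mono) auto
      also have "\<dots> \<le> card ({1..n} - {u})"
        by (rule card_image_le) simp
      also have "\<dots> \<le> card {1..n}"
        by (intro card_mono) auto
      finally show ?thesis
        by simp
    qed
    then have "AE \<omega> in M. \<forall>\<^sub>F n in sequentially. \<forall>K \<in> KK n.
        \<bar>card (common_nbrs (R \<omega>) {1..n} K) - p ^ 2 * (real n - real 2)\<bar> < \<epsilon> / 2 * n"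
      using \<open>\<epsilon> > 0\<close>
      by (intro erdos_renyi_common_nbrs_AE[OF er]) (auto simp: KK_def card_2_iff)
    with AE_space show "AE \<omega> in M. \<forall>\<^sub>F n in sequentially.
        \<bar>(t \<omega> n - p\<^sup>2 * (real n - 2) * d \<omega> n) / (real n)\<^sup>2\<bar> < \<epsilon>"
    proof eventually_elim
      case (elim \<omega>)
      then have sg: "simple_graph (R \<omega>)"
        using er by (simp add: erdos_renyi_def)
      from elim(2) eventually_ge_at_top[of u] show ?case
      proof eventually_elim
        case (elim n)
        define N where "N = nbrs (induced (R \<omega>) {1..n}) u"
        have u: "u \<in> {1..n}"
          using elim(2) \<open>u \<ge> 1\<close> by simp
        have N_sub: "N \<subseteq> {1..n} - {u}"
          using edge_verts(3)[OF sg] by (auto simp: N_def nbrs_def induced_def)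
        have "card N \<le> n"
          using card_mono[OF _ N_sub] u by simp
        \<comment> \<open>Since \<open>d \<omega> n\<close> is the cardinality of \<open>N\<close>,
          the mean can be subtracted from each summand.\<close>
        have "\<bar>t \<omega> n - p\<^sup>2 * (real n - 2) * d \<omega> n\<bar>
            = \<bar>\<Sum>k\<in>N. card (common_nbrs (R \<omega>) {1..n} {u, k}) - p\<^sup>2 * (real n - 2)\<bar>"
          by (simp add: t_def d_def card_nbr_links_induced[OF sg] vdeg_def N_def sum_subtractf mult.commute)
        also have "\<dots> \<le> (\<Sum>k\<in>N. \<epsilon> / 2 * n)"
        proof (rule order_trans[OF sum_abs], rule sum_mono)
          fix k assume "k \<in> N"
          then have "{u, k} \<in> KK n"
            using N_sub u by (auto simp: KK_def)
          with elim(1) show "\<bar>card (common_nbrs (R \<omega>) {1..n} {u, k}) - p\<^sup>2 * (real n - 2)\<bar> \<le> \<epsilon> / 2 * n"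
            by fastforce
        qed
        also have "\<dots> \<le> n * (\<epsilon> / 2 * n)"
          using \<open>card N \<le> n\<close> \<open>\<epsilon> > 0\<close> by (simp add: mult_right_mono)
        also have "\<dots> < \<epsilon> * (real n)\<^sup>2"
          using u \<open>\<epsilon> > 0\<close> by (simp add: power2_eq_square)
        finally show ?case
          using u by (simp add: divide_less_eq)
      qed
    qed
  qed
  with erdos_renyi_vdeg_AE[OF assms] show ?thesis
  proof eventually_elim
    case (elim \<omega>)
    have "(\<lambda>n. p\<^sup>2 * ((real n - 2) / n)) \<longlonglongrightarrow> p\<^sup>2"
      by real_asymp
    from tendsto_add[OF elim(2) tendsto_mult[OF this elim(1)]]
    have "(\<lambda>n. (t \<omega> n - p\<^sup>2 * (real n - 2) * d \<omega> n) / (real n)\<^sup>2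
        + p\<^sup>2 * ((real n - 2) / n) * (d \<omega> n / n)) \<longlonglongrightarrow> p ^ 3"
      by (simp add: d_def power3_eq_cube power2_eq_square)
    \<comment> \<open>The identity includes \<open>m = 0\<close>, where every quotient is 0.\<close>
    moreover have "(x - q * c * y) / m\<^sup>2 + q * (c / m) * (y / m) = x / m\<^sup>2" for x q c y m :: real
      by (simp add: diff_divide_distrib power2_eq_square)
    ultimately show ?case
      by (simp only: t_def)
  qed
qed

theorem theorem5p1:
  fixes M :: "'w measure" and p :: real and G H :: "'w \<Rightarrow> nat ugraph" and u v :: nat
  assumes "prob_space M"
    and "0 < p" and "p < 1"
    and "erdos_renyi M {1..} p G"
    and "erdos_renyi M {1..} p H"
    and "indep_graphs M {1..} G {1..} H"
    and "u \<ge> 1" and "v \<ge> 1"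
  shows "AE \<omega> in M.
    (\<lambda>n. local_efficiency
           (tensor_product (induced (G \<omega>) {1..n}) (induced (H \<omega>) {1..n})) (u, v))
    \<longlonglongrightarrow> 1 / 2 + 1 / 2 * p\<^sup>2"
proof -
  interpret prob_space M
    by (rule assms(1))
  note G = \<open>erdos_renyi M {1..} p G\<close> and H = \<open>erdos_renyi M {1..} p H\<close>
  have simple: "simple_graph (induced (R \<omega>) S)"
    if "erdos_renyi M {1..} p R" "\<omega> \<in> space M" for R :: "'w \<Rightarrow> nat ugraph" and S \<omega>
    using that by (simp add: erdos_renyi_def simple_graph_induced)
  \<comment> \<open>The four limits hold simultaneously off one null set, and there the
    deterministic limit applies to each \<open>\<omega>\<close>.\<close>
  from AE_space erdos_renyi_vdeg_AE[OF G \<open>u \<ge> 1\<close>] erdos_renyi_nbr_links_AE[OF G \<open>u \<ge> 1\<close>]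
    erdos_renyi_vdeg_AE[OF H \<open>v \<ge> 1\<close>] erdos_renyi_nbr_links_AE[OF H \<open>v \<ge> 1\<close>]
  show ?thesis
  proof eventually_elim
    case (elim \<omega>)
    then show ?case
      using \<open>0 < p\<close> simple[OF G] simple[OF H]
      by (intro local_efficiency_tensor_product_tendsto finite_nbrs_induced) auto
  qed
qed

end
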